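(* Let $D,d,L\ge 1$ be integers and let $p(x)=\sum_{|\mathbf n|\le d}p_{\mathbf n}x^{\mathbf n}$ be a real polynomial in $D$ variables of degree at most $d$. Then the problem $$\text{(P)}\qquad \min_{x\in[-1,1]^D} p(x)$$ and the problem $$\text{(R)}\qquad \min_{\mu}\ \sum_{\mathbf n\in\mathrm{supp}(p)}p_{\mathbf n}\,\phi_{\mathbf n}(\mu),\qquad \phi_{\mathbf n}(\mu):=\sum_{l=1}^L\prod_{i=1}^D\mu^{(l)}_{i,\mathbf n_i},$$ where the minimum in (R) is over all $\mu=\{(\mu^{(l)}_1,\dots,\mu^{(l)}_D)\}_{l=1}^L\in\mathbb R^{(2d+1)\times D\times L}$ satisfying $\mathcal M_d(\mu_i^{(l)})\succeq 0$ and $\mathcal M_{d-1}(\mu_i^{(l)};1-x_i^2)\succeq 0$ for all $i=1,\dots,D$ and $l=1,\dots,L$, and $\phi_{(0,\dots,0)}(\mu)=1$, share the same global minimum value.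
   Context: Multi-indices are $\mathbf n=(\mathbf n_1,\dots,\mathbf n_D)$ with nonnegative integer entries, $|\mathbf n|=\sum_i\mathbf n_i$, $x^{\mathbf n}=\prod_i x_i^{\mathbf n_i}$, and $\mathrm{supp}(p)=\{\mathbf n: p_{\mathbf n}\neq 0\}$. Each $\mu_i^{(l)}=(\mu^{(l)}_{i,0},\dots,\mu^{(l)}_{i,2d})\in\mathbb R^{2d+1}$ is a real vector. For a vector $\nu=(\nu_0,\dots,\nu_{2d})\in\mathbb R^{2d+1}$: $\mathcal M_d(\nu)$ is the $(d+1)\times(d+1)$ matrix with entries $[\mathcal M_d(\nu)]_{m,n}=\nu_{m+n}$, $0\le m,n\le d$; and $\mathcal M_{d-1}(\nu;1-x^2)$ is the $d\times d$ matrix with entries $\nu_{m+n}-\nu_{m+n+2}$, $0\le m,n\le d-1$. $A\succeq0$ means that $A$ is positive semi-definite. *)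

theory Defs
  imports
    Complex_Main
    "HOL-Library.Poly_Mapping"
    "HOL-Library.FuncSet"
    "Jordan_Normal_Form.Matrix"
begin

(* A multi-index in D variables is a finitely supported map n with keys in {1..D};
   a real polynomial is a finitely supported family of coefficients indexed by
   multi-indices, so that supp(p) is keys p. *)
type_synonym multi_index = "nat \<Rightarrow>\<^sub>0 nat"
type_synonym real_mpoly = "multi_index \<Rightarrow>\<^sub>0 real"

definition multi_indices :: "nat \<Rightarrow> multi_index set" where
  "multi_indices D = {n. Poly_Mapping.keys n \<subseteq> {1..D}}"

definition mi_size :: "nat \<Rightarrow> multi_index \<Rightarrow> nat" where
  "mi_size D n = (\<Sum>i=1..D. Poly_Mapping.lookup n i)"

definition mpolys_upto :: "nat \<Rightarrow> nat \<Rightarrow> real_mpoly set" where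
  "mpolys_upto D d = {p. Poly_Mapping.keys p \<subseteq> {n \<in> multi_indices D. mi_size D n \<le> d}}"

definition monomial_val :: "nat \<Rightarrow> multi_index \<Rightarrow> (nat \<Rightarrow> real) \<Rightarrow> real" where
  "monomial_val D n x = (\<Prod>i=1..D. x i ^ Poly_Mapping.lookup n i)"

definition mpoly_val :: "nat \<Rightarrow> real_mpoly \<Rightarrow> (nat \<Rightarrow> real) \<Rightarrow> real" where
  "mpoly_val D p x = (\<Sum>n\<in>Poly_Mapping.keys p. Poly_Mapping.lookup p n * monomial_val D n x)"

definition sym_cube :: "nat \<Rightarrow> (nat \<Rightarrow> real) set" where
  "sym_cube D = {1..D} \<rightarrow>\<^sub>E {-1..1}"

definition psd :: "real mat \<Rightarrow> bool" where
  "psd A \<longleftrightarrow> square_mat A \<and> transpose_mat A = A \<and>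
     (\<forall>v \<in> carrier_vec (dim_row A). 0 \<le> v \<bullet> (A *\<^sub>v v))"

definition moment_mat :: "nat \<Rightarrow> real vec \<Rightarrow> real mat" where
  "moment_mat d \<nu> = mat (d + 1) (d + 1) (\<lambda>(m, n). \<nu> $ (m + n))"

(* This is M_{d-1}(\<nu>; 1 - x^2): the parameter d is its dimension. *)
definition localizing_mat :: "nat \<Rightarrow> real vec \<Rightarrow> real mat" where
  "localizing_mat d \<nu> = mat d d (\<lambda>(m, n). \<nu> $ (m + n) - \<nu> $ (m + n + 2))"

(* \<mu> l i is the vector \<mu>_i^(l), whose entries are indexed by 0, ..., 2 d. *)
type_synonym moment_family = "nat \<Rightarrow> nat \<Rightarrow> real vec"

definition phi :: "nat \<Rightarrow> nat \<Rightarrow> multi_index \<Rightarrow> moment_family \<Rightarrow> real" where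
  "phi D L n \<mu> = (\<Sum>l=1..L. \<Prod>i=1..D. \<mu> l i $ Poly_Mapping.lookup n i)"

definition relax_feasible :: "nat \<Rightarrow> nat \<Rightarrow> nat \<Rightarrow> moment_family set" where
  "relax_feasible D d L =
     {\<mu> \<in> {1..L} \<rightarrow>\<^sub>E ({1..D} \<rightarrow>\<^sub>E carrier_vec (2 * d + 1)).
        (\<forall>l\<in>{1..L}. \<forall>i\<in>{1..D}. psd (moment_mat d (\<mu> l i)) \<and> psd (localizing_mat d (\<mu> l i))) \<and>
        phi D L 0 \<mu> = 1}"

definition relax_objective :: "nat \<Rightarrow> nat \<Rightarrow> real_mpoly \<Rightarrow> moment_family \<Rightarrow> real" where
  "relax_objective D L p \<mu> = (\<Sum>n\<in>Poly_Mapping.keys p. Poly_Mapping.lookup p n * phi D L n \<mu>)"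

end

theory Submission
  imports
    Defs
    "HOL-Computational_Algebra.Fundamental_Theorem_Algebra"
    "HOL-Analysis.Function_Topology"
begin

text \<open>
  The relaxation never goes below the minimum of \<open>p\<close>, because a vector satisfying the two
  semidefiniteness constraints behaves, on polynomials of degree at most \<open>d\<close>, like the moments of a
  positive measure on \<open>[-1, 1]\<close>. No measure has to be constructed. Each vector \<open>\<nu>\<close> defines the linear
  functional (\<open>riesz\<close>) that sends \<open>x ^ n\<close> to \<open>\<nu> $ n\<close>, and the constraints say exactly that this
  functional is nonnegative on \<open>s\<^sup>2\<close> for \<open>degree s \<le> d\<close> and on \<open>(1 - x\<^sup>2) * s\<^sup>2\<close> for
  \<open>degree s < d\<close>.

  A polynomial of degree at most \<open>d\<close> that is nonnegative on \<open>[-1, 1]\<close> is a sum of such terms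
  (\<open>nonneg_on_interval_imp_quad_module\<close>): it is a product of linear and quadratic factors that are
  nonnegative on the interval, each of these has such a certificate, and certificates multiply. A
  factor of degree 1 may cost a certificate of degree 2, since
  \<open>1 - x = ((1 - x)\<^sup>2 + (1 - x\<^sup>2)) / 2\<close>; this loss is affordable because the moment
  vectors reach up to degree \<open>2 * d\<close>, whereas \<open>p\<close> has degree only \<open>d\<close>.

  For a minimum \<open>m\<close> of \<open>p\<close> on the cube, \<open>p - m\<close> is nonnegative there. Applying the functional
  of the first variable with the other variables held fixed in \<open>[-1, 1]\<close> leaves a
  polynomial in the other variables that is nonnegative on the smaller cube; repeating this for all
  variables (\<open>product_moments_nonneg\<close>) shows that every \<open>l\<close> contributes at least \<open>m\<close> times its
  total mass, and these masses sum to 1.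

  Conversely, the powers of the coordinates of a minimizer, placed in the summand \<open>l = 1\<close> with
  zero vectors in all other summands, are feasible and attain \<open>m\<close>.
\<close>

section \<open>Certificates of nonnegativity on the interval\<close>

text \<open>
  The truncated quadratic module generated by \<open>1 - x\<^sup>2\<close>. The bound \<open>k\<close> is half the degree: every
  summand has degree at most \<open>2 * k\<close>.
\<close>

inductive quad_module :: "nat \<Rightarrow> real poly \<Rightarrow> bool" for k where
  square: "degree s \<le> k \<Longrightarrow> quad_module k (s * s)"
| weighted: "degree s + 1 \<le> k \<Longrightarrow> quad_module k ([:1, 0, -1:] * (s * s))"
| add: "quad_module k f \<Longrightarrow> quad_module k g \<Longrightarrow> quad_module k (f + g)"

lemma quad_module_mono:
  assumes "quad_module j f" "j \<le> k"
  shows "quad_module k f"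
  using assms
proof (induction rule: quad_module.induct)
  case (square s)
  then show ?case by (intro quad_module.square) simp
next
  case (weighted s)
  then show ?case by (intro quad_module.weighted) simp
next
  case (add f g)
  then show ?case by (intro quad_module.add) simp_all
qed

lemma quad_module_const: "0 \<le> c \<Longrightarrow> quad_module k [:c:]"
  using quad_module.square[of "[:sqrt c:]" k] by simp

lemma quad_module_nonneg:
  assumes "quad_module k f" "x \<in> {-1..1}"
  shows "0 \<le> poly f x"
  using assms
proof (induction rule: quad_module.induct)
  case (weighted s)
  then have "x\<^sup>2 \<le> 1" by (simp add: abs_square_le_1 abs_le_iff)
  then have "0 \<le> (1 - x\<^sup>2) * (poly s x * poly s x)" by simp
  then show ?case by (simp add: power2_eq_square algebra_simps)
qed simp_all

text \<open>
  The only product that is not immediate is that of two weighted squares, where the two weights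
  combine into the square of \<open>1 - x\<^sup>2\<close>. Degree bounds add up in all cases, so the certificate of a
  product of factors is controlled by the sum of their degrees.
\<close>

lemma quad_module_mult:
  assumes "quad_module j f" "quad_module k g"
  shows "quad_module (j + k) (f * g)"
  using assms(1)
proof (induction rule: quad_module.induct)
  case (square s)
  show ?case using assms(2)
  proof (induction rule: quad_module.induct)
    case (square t)
    have "degree (s * t) \<le> j + k"
      using degree_mult_le[of s t] square \<open>degree s \<le> j\<close> by linarith
    from quad_module.square[OF this] show ?case by (simp add: ac_simps)
  next
    case (weighted t)
    have "degree (s * t) + 1 \<le> j + k"
      using degree_mult_le[of s t] weighted \<open>degree s \<le> j\<close> by linarith
    from quad_module.weighted[OF this] show ?case by (simp only: ac_simps)
  next
    case (add f g)
    then show ?case by (simp add: distrib_left quad_module.add)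
  qed
next
  case (weighted s)
  show ?case using assms(2)
  proof (induction rule: quad_module.induct)
    case (square t)
    have "degree (s * t) + 1 \<le> j + k"
      using degree_mult_le[of s t] square \<open>degree s + 1 \<le> j\<close> by linarith
    from quad_module.weighted[OF this] show ?case by (simp only: ac_simps)
  next
    case (weighted t)
    have "degree ([:1, 0, -1:] * (s * t)) \<le> degree [:1, 0, -1::real:] + (degree s + degree t)"
      by (rule order_trans[OF degree_mult_le]) (simp add: degree_mult_le)
    also have "\<dots> \<le> j + k"
      using weighted \<open>degree s + 1 \<le> j\<close> by simp
    finally have "degree ([:1, 0, -1:] * (s * t)) \<le> j + k" .
    from quad_module.square[OF this] show ?case by (simp only: ac_simps)
  next
    case (add f g)
    then show ?case by (simp only: distrib_left quad_module.add)
  qed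
next
  case (add f1 f2)
  then show ?case by (simp add: distrib_right quad_module.add)
qed

text \<open>
  Covers \<open>a - x\<close> and \<open>a + x\<close> at once: for \<open>c = 1\<close> or \<open>c = -1\<close>,
  \<open>a + c x = (a - 1) + ((1 + c x)\<^sup>2 + (1 - x\<^sup>2)) / 2\<close>.
\<close>

lemma quad_module_linear:
  assumes "\<bar>c\<bar> = 1" "1 \<le> a"
  shows "quad_module 1 [:a, c:]"
proof -
  \<comment> \<open>distributes the factor 1/2 over the two square terms\<close>
  define r where "r = sqrt (1 / 2)"
  have r: "r * r = 1 / 2" by (simp add: r_def)
  have c: "c * c = 1" using assms(1) by (metis abs_mult_self_eq mult_1)
  have "quad_module 1 [:a - 1:]"
    using assms(2) by (intro quad_module_const) simp
  moreover have "quad_module 1 ([:r, c * r:] * [:r, c * r:])"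
    by (rule quad_module.square) simp
  moreover have "quad_module 1 ([:1, 0, -1:] * ([:r:] * [:r:]))"
    by (rule quad_module.weighted) simp
  moreover have "[:a, c:] = [:a - 1:] + [:r, c * r:] * [:r, c * r:] + [:1, 0, -1:] * ([:r:] * [:r:])"
  proof -
    have "c * r * r = c * (r * r)" "c * r * (c * r) = (c * c) * (r * r)" by (simp_all only: ac_simps)
    then have "r * (c * r) = c / 2" "c * r * r = c / 2" "c * r * (c * r) = 1 / 2"
      unfolding c r by (simp_all add: mult.commute)
    then show ?thesis using r c by simp
  qed
  ultimately show ?thesis by (metis quad_module.add)
qed

text \<open>
  The real quadratic with roots \<open>a + b i\<close> and \<open>a - b i\<close> is \<open>(x - a)\<^sup>2 + b\<^sup>2\<close>.
\<close>

lemma quad_module_complex_pair: "quad_module 1 [:a\<^sup>2 + b\<^sup>2, - 2 * a, 1:]"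
proof -
  have "quad_module 1 ([:- a, 1:] * [:- a, 1:] + [:b:] * [:b:])"
    by (intro quad_module.add quad_module.square) simp_all
  then show ?thesis by (simp add: power2_eq_square algebra_simps)
qed

text \<open>
  Splitting off a nonnegative factor preserves nonnegativity, even at the zeros of that factor: if
  \<open>g\<close> were negative at \<open>t\<close>, it would be negative on infinitely many points of the interval, and
  \<open>q\<close> is positive at all but finitely many of them.
\<close>

lemma cofactor_nonneg:
  fixes q g :: "real poly"
  assumes "q \<noteq> 0"
    and q: "\<And>x. x \<in> {-1..1} \<Longrightarrow> 0 \<le> poly q x"
    and qg: "\<And>x. x \<in> {-1..1} \<Longrightarrow> 0 \<le> poly (q * g) x"
    and t: "t \<in> {-1..1}"
  shows "0 \<le> poly g t"
proof (rule ccontr)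
  assume "\<not> 0 \<le> poly g t"
  moreover have "(poly g \<longlongrightarrow> poly g t) (at t)" using poly_isCont[of t g] by (simp add: isCont_def)
  ultimately have "\<forall>\<^sub>F x in at t. poly g x < 0" by (intro order_tendstoD(2)) auto
  then obtain e where e: "e > 0" "\<And>x. x \<noteq> t \<Longrightarrow> \<bar>x - t\<bar> < e \<Longrightarrow> poly g x < 0"
    by (auto simp: eventually_at dist_real_def)
  define lo where "lo = max (-1) (t - e)"
  define hi where "hi = min 1 (t + e)"
  have "lo < hi" using e(1) t by (auto simp: lo_def hi_def)
  then have "infinite {lo<..<hi}" by (rule infinite_Ioo)
  moreover have "finite (insert t {x. poly q x = 0})" using poly_roots_finite[OF assms(1)] by simp
  ultimately obtain x where x: "x \<in> {lo<..<hi}" "poly q x \<noteq> 0" "x \<noteq> t"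
    by (metis (mono_tags, lifting) finite_subset insertCI mem_Collect_eq subsetI)
  then have "x \<in> {-1..1}" "\<bar>x - t\<bar> < e" by (auto simp: lo_def hi_def)
  then have "0 < poly q x" "poly g x < 0" "0 \<le> poly q x * poly g x"
    using e(2)[of x] q[of x] qg[of x] x(2,3) by auto
  then show False using mult_pos_neg[of "poly q x" "poly g x"] by linarith
qed

text \<open>
  An interior zero of a nonnegative polynomial is a local minimum, so the derivative vanishes there
  and the zero is at least double.
\<close>

lemma root_in_interior_double:
  fixes f :: "real poly"
  assumes f: "\<And>x. x \<in> {-1..1} \<Longrightarrow> 0 \<le> poly f x"
    and a: "poly f a = 0" "-1 < a" "a < 1"
  shows "[:- a, 1:] * [:- a, 1:] dvd f"
proof -
  obtain g where g: "f = [:- a, 1:] * g" using a(1) poly_eq_0_iff_dvd[of f a] by (auto elim: dvdE)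
  have "poly (pderiv f) a = 0"
  proof (rule DERIV_local_min[OF poly_DERIV])
    show "0 < min (1 - a) (1 + a)" using a by simp
    show "\<forall>y. \<bar>a - y\<bar> < min (1 - a) (1 + a) \<longrightarrow> poly f a \<le> poly f y"
      using f a(1) by (auto simp: abs_less_iff)
  qed
  then have "poly g a = 0" by (simp add: g pderiv_mult pderiv_pCons del: mult_pCons_left)
  then have "[:- a, 1:] dvd g" by (simp add: poly_eq_0_iff_dvd)
  then show ?thesis unfolding g by (rule mult_dvd_mono[OF dvd_refl])
qed

lemma map_poly_of_real_add:
  "map_poly complex_of_real (f + g) = map_poly complex_of_real f + map_poly complex_of_real g"
  by (rule poly_eqI) (simp add: coeff_map_poly)

lemma poly_of_real_mult:
  "poly (map_poly complex_of_real (f * g)) z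
     = poly (map_poly complex_of_real f) z * poly (map_poly complex_of_real g) z"
proof -
  have smult: "map_poly complex_of_real (smult c g) = smult (of_real c) (map_poly complex_of_real g)" for c g
    by (rule poly_eqI) (simp add: coeff_map_poly)
  show ?thesis
    by (induction f) (simp_all add: map_poly_of_real_add smult map_poly_pCons algebra_simps)
qed

lemma nonreal_root_quadratic_dvd:
  fixes f :: "real poly"
  assumes z: "poly (map_poly complex_of_real f) z = 0" and "Im z \<noteq> 0"
  shows "[:(Re z)\<^sup>2 + (Im z)\<^sup>2, - 2 * Re z, 1:] dvd f"
proof -
  let ?q = "[:(Re z)\<^sup>2 + (Im z)\<^sup>2, - 2 * Re z, 1:]"
  have q0: "poly (map_poly complex_of_real ?q) z = 0"
    by (simp add: map_poly_pCons complex_eq_iff power2_eq_square algebra_simps)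
  \<comment> \<open>The remainder is a real linear polynomial with a nonreal root, hence zero.\<close>
  have "degree (f mod ?q) \<le> 1"
    using degree_mod_less[of ?q f] by auto
  then have "f mod ?q = [:coeff (f mod ?q) 0, coeff (f mod ?q) 1:]"
    by (intro poly_eqI) (auto simp: coeff_pCons coeff_eq_0 split: nat.splits)
  then obtain b c where r: "f mod ?q = [:b, c:]" by blast
  have "poly (map_poly complex_of_real (?q * (f div ?q) + f mod ?q)) z = 0"
    using z by (simp only: mult_div_mod_eq)
  then have "complex_of_real b + z * of_real c = 0"
    unfolding map_poly_of_real_add poly_add poly_of_real_mult q0 r by (simp add: map_poly_pCons)
  then have "c = 0" "b = 0"
    using \<open>Im z \<noteq> 0\<close> by (auto simp: complex_eq_iff)
  then show ?thesis using r by (simp add: dvd_eq_mod_eq_0)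
qed

text \<open>
  The fundamental theorem of algebra gives a complex root, and the factor depends on its position:
  a nonreal root comes with its conjugate, a root inside the interval is double, and a real root
  outside the open interval gives a linear factor of constant sign on the interval.
\<close>

lemma nonneg_poly_has_quad_module_factor:
  fixes f :: "real poly"
  assumes f: "\<And>x. x \<in> {-1..1} \<Longrightarrow> 0 \<le> poly f x" and deg: "0 < degree f"
  obtains q where "q dvd f" "0 < degree q" "quad_module (degree q) q"
proof -
  have "degree (map_poly complex_of_real f) = degree f"
    by (rule degree_map_poly) (simp add: deg)
  then have "\<not> constant (poly (map_poly complex_of_real f))"
    using deg by (simp add: constant_degree)
  from fundamental_theorem_of_algebra[OF this]
  obtain z where z: "poly (map_poly complex_of_real f) z = 0" by blast
  show ?thesis
  proof (cases "Im z = 0")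
    case False
    have "quad_module (Suc (Suc 0)) [:(Re z)\<^sup>2 + (Im z)\<^sup>2, - 2 * Re z, 1:]"
      by (rule quad_module_mono[OF quad_module_complex_pair]) simp
    then show ?thesis
      by (intro that[OF nonreal_root_quadratic_dvd[OF z False]]) simp_all
  next
    case True
    define a where "a = Re z"
    have "z = of_real a" using True by (simp add: a_def complex_eq_iff)
    moreover have "poly (map_poly complex_of_real f) (of_real a) = of_real (poly f a)"
      by (induction f) (simp_all add: map_poly_pCons)
    ultimately have a: "poly f a = 0" using z by simp
    then have dvd: "[:- a, 1:] dvd f" by (simp add: poly_eq_0_iff_dvd)
    consider "-1 < a" "a < 1" | "a \<le> -1" | "1 \<le> a" by linarith
    then show ?thesis
    proof cases
      case 1
      have "quad_module (Suc (Suc 0)) ([:- a, 1:] * [:- a, 1:])" by (rule quad_module.square) simp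
      then show ?thesis
        by (intro that[OF root_in_interior_double[OF f a 1]]) simp_all
    next
      case 2
      with dvd quad_module_linear[of 1 "-a"] show ?thesis by (intro that) auto
    next
      case 3
      have "[:a, -1:] dvd f" using dvd minus_dvd_iff[of "[:- a, 1:]" f] by simp
      with 3 quad_module_linear[of "-1" a] show ?thesis by (intro that) auto
    qed
  qed
qed

text \<open>
  The bound \<open>degree f\<close> allows certificates of twice the degree of \<open>f\<close>. Sharper bounds hold, but
  this one needs no distinction of parities: factors are split off one by one, and the factor and
  the remaining cofactor satisfy the statement separately.
\<close>

lemma nonneg_on_interval_imp_quad_module:
  assumes "\<And>x. x \<in> {-1..1} \<Longrightarrow> 0 \<le> poly f x"
  shows "quad_module (degree f) f"
  using assms
proof (induction "degree f" arbitrary: f rule: less_induct)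
  case less
  show ?case
  proof (cases "degree f = 0")
    case True
    then obtain c where "f = [:c:]" by (auto elim: degree_eq_zeroE)
    with less.prems[of 0] show ?thesis by (simp add: quad_module_const)
  next
    case False
    then obtain q where q: "q dvd f" "0 < degree q" "quad_module (degree q) q"
      using nonneg_poly_has_quad_module_factor[of f] less.prems by blast
    then obtain g where g: "f = q * g" by (auto elim: dvdE)
    with False have nz: "q \<noteq> 0" "g \<noteq> 0" by auto
    then have deg: "degree f = degree q + degree g" by (simp add: g degree_mult_eq)
    have "0 \<le> poly g x" if "x \<in> {-1..1}" for x
      using cofactor_nonneg[OF nz(1) quad_module_nonneg[OF q(3)] _ that, of g] less.prems g by simp
    then have "quad_module (degree g) g"
      using less.hyps[of g] deg q(2) by simp
    with q(3) show ?thesis unfolding deg unfolding g by (rule quad_module_mult)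
  qed
qed

section \<open>Truncated moment vectors\<close>

definition riesz :: "real vec \<Rightarrow> real poly \<Rightarrow> real" where
  "riesz \<nu> f = (\<Sum>n<dim_vec \<nu>. coeff f n * \<nu> $ n)"

lemma riesz_add: "riesz \<nu> (f + g) = riesz \<nu> f + riesz \<nu> g"
  by (simp add: riesz_def algebra_simps sum.distrib)

lemma riesz_sum: "riesz \<nu> (sum f A) = (\<Sum>a\<in>A. riesz \<nu> (f a))"
  by (induction A rule: infinite_finite_induct) (simp_all add: riesz_add, simp_all add: riesz_def)

lemma riesz_monom: "n < dim_vec \<nu> \<Longrightarrow> riesz \<nu> (monom c n) = c * \<nu> $ n"
  by (simp add: riesz_def if_distrib[of "\<lambda>t. t * _"] sum.delta cong: if_cong)

lemma square_as_sum_of_monoms: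
  fixes s :: "real poly"
  assumes "degree s < k"
  shows "s * s = (\<Sum>i<k. \<Sum>j<k. monom (coeff s i * coeff s j) (i + j))"
proof -
  have "s = (\<Sum>i<k. monom (coeff s i) i)"
    using assms by (intro poly_eqI) (auto simp: coeff_sum coeff_eq_0)
  then have "s * s = (\<Sum>i<k. monom (coeff s i) i) * (\<Sum>j<k. monom (coeff s j) j)" by simp
  then show ?thesis by (simp only: sum_product mult_monom)
qed

text \<open>
  The moment matrix and the localizing matrix are both Hankel matrices, so one computation of the
  quadratic form serves for both.
\<close>

lemma psd_hankel_iff:
  "psd (mat k k (\<lambda>(i, j). a (i + j))) \<longleftrightarrow>
     (\<forall>c :: nat \<Rightarrow> real. 0 \<le> (\<Sum>i<k. \<Sum>j<k. c i * c j * a (i + j)))"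
  (is "psd ?A \<longleftrightarrow> ?R")
proof -
  have quad: "v \<bullet> (?A *\<^sub>v v) = (\<Sum>i<k. \<Sum>j<k. v $ i * v $ j * a (i + j))"
    if "v \<in> carrier_vec k" for v
    using that by (simp add: scalar_prod_def sum_distrib_left atLeast0LessThan ac_simps)
  have "transpose_mat ?A = ?A" by (intro eq_matI) (auto simp: add.commute)
  then have "psd ?A \<longleftrightarrow> (\<forall>v\<in>carrier_vec k. 0 \<le> v \<bullet> (?A *\<^sub>v v))"
    by (simp add: psd_def)
  also have "\<dots> \<longleftrightarrow> ?R"
  proof (intro iffI allI ballI)
    fix c :: "nat \<Rightarrow> real"
    assume "\<forall>v\<in>carrier_vec k. 0 \<le> v \<bullet> (?A *\<^sub>v v)"
    then have "0 \<le> vec k c \<bullet> (?A *\<^sub>v vec k c)" by simp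
    then show "0 \<le> (\<Sum>i<k. \<Sum>j<k. c i * c j * a (i + j))" by (subst (asm) quad) simp_all
  next
    fix v :: "real vec" assume "?R" "v \<in> carrier_vec k"
    then show "0 \<le> v \<bullet> (?A *\<^sub>v v)" by (simp only: quad)
  qed
  finally show ?thesis .
qed

text \<open>
  The constraints that the relaxation imposes on each single vector.
\<close>

definition pseudo_moments :: "nat \<Rightarrow> real vec \<Rightarrow> bool" where
  "pseudo_moments d \<nu> \<longleftrightarrow>
     \<nu> \<in> carrier_vec (2 * d + 1) \<and> psd (moment_mat d \<nu>) \<and> psd (localizing_mat d \<nu>)"

lemma moment_mat_psd_iff:
  "psd (moment_mat d \<nu>) \<longleftrightarrow>
     (\<forall>c :: nat \<Rightarrow> real. 0 \<le> (\<Sum>i<d + 1. \<Sum>j<d + 1. c i * c j * \<nu> $ (i + j)))"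
  unfolding moment_mat_def by (rule psd_hankel_iff)

lemma localizing_mat_psd_iff:
  "psd (localizing_mat d \<nu>) \<longleftrightarrow>
     (\<forall>c :: nat \<Rightarrow> real. 0 \<le> (\<Sum>i<d. \<Sum>j<d. c i * c j * (\<nu> $ (i + j) - \<nu> $ (i + j + 2))))"
  unfolding localizing_mat_def by (rule psd_hankel_iff[of d "\<lambda>m. \<nu> $ m - \<nu> $ (m + 2)"])

text \<open>
  The functional evaluated at \<open>s\<^sup>2\<close> is the quadratic form of the moment matrix at the coefficients
  of \<open>s\<close>, and at \<open>(1 - x\<^sup>2) * s\<^sup>2\<close> it is that of the localizing matrix.
\<close>

lemma riesz_quad_module_nonneg:
  assumes \<nu>: "pseudo_moments d \<nu>" and f: "quad_module d f"
  shows "0 \<le> riesz \<nu> f"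
  using f
proof (induction rule: quad_module.induct)
  case (square s)
  then have deg: "degree s < d + 1" by simp
  have "riesz \<nu> (s * s) = (\<Sum>i<d + 1. \<Sum>j<d + 1. coeff s i * coeff s j * \<nu> $ (i + j))"
    using \<nu> unfolding square_as_sum_of_monoms[OF deg] riesz_sum
    by (intro sum.cong refl riesz_monom) (auto simp: pseudo_moments_def)
  then show ?case using \<nu> by (simp only: pseudo_moments_def moment_mat_psd_iff)
next
  case (weighted s)
  have deg: "degree s < d" using weighted by simp
  have dim: "dim_vec \<nu> = 2 * d + 1" using \<nu> by (simp add: pseudo_moments_def)
  have "[:1, 0, -1:] * (s * s) = (s * s) + monom (-1) 2 * (s * s)"
    by (simp add: monom_altdef numeral_2_eq_2 algebra_simps)
  also have "monom (-1) 2 * (s * s)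
      = (\<Sum>i<d. \<Sum>j<d. monom (- (coeff s i * coeff s j)) (i + j + 2))"
    unfolding square_as_sum_of_monoms[OF deg] sum_distrib_left mult_monom by (simp add: add.commute)
  finally have "riesz \<nu> ([:1, 0, -1:] * (s * s))
      = (\<Sum>i<d. \<Sum>j<d. riesz \<nu> (monom (coeff s i * coeff s j) (i + j)))
        + (\<Sum>i<d. \<Sum>j<d. riesz \<nu> (monom (- (coeff s i * coeff s j)) (i + j + 2)))"
    unfolding square_as_sum_of_monoms[OF deg] by (simp only: riesz_add riesz_sum)
  also have "\<dots> = (\<Sum>i<d. \<Sum>j<d. coeff s i * coeff s j * (\<nu> $ (i + j) - \<nu> $ (i + j + 2)))"
    unfolding sum.distrib[symmetric]
    by (intro sum.cong refl) (simp add: riesz_monom dim right_diff_distrib)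
  finally show ?case using \<nu> by (simp only: pseudo_moments_def localizing_mat_psd_iff)
qed (simp add: riesz_add)

lemma riesz_nonneg:
  assumes "pseudo_moments d \<nu>" "degree f \<le> d" "\<And>x. x \<in> {-1..1} \<Longrightarrow> 0 \<le> poly f x"
  shows "0 \<le> riesz \<nu> f"
  using riesz_quad_module_nonneg[OF assms(1)]
    quad_module_mono[OF nonneg_on_interval_imp_quad_module assms(2)] assms(3) by blast

definition point_moments :: "nat \<Rightarrow> real \<Rightarrow> real vec" where
  "point_moments d x = vec (2 * d + 1) (\<lambda>n. x ^ n)"

text \<open>
  Both quadratic forms collapse to squares of \<open>\<Sum>i. c i * x ^ i\<close>, in the localizing case with the
  factor \<open>1 - x\<^sup>2\<close>.
\<close>

lemma pseudo_moments_point: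
  assumes "x \<in> {-1..1}"
  shows "pseudo_moments d (point_moments d x)"
proof -
  have sq: "(\<Sum>i<k. \<Sum>j<k. c i * c j * x ^ (i + j)) = (\<Sum>i<k. c i * x ^ i)\<^sup>2"
    for k and c :: "nat \<Rightarrow> real"
    by (simp add: power2_eq_square sum_product power_add ac_simps)
  have "(\<Sum>i<d + 1. \<Sum>j<d + 1. c i * c j * point_moments d x $ (i + j)) = (\<Sum>i<d + 1. c i * x ^ i)\<^sup>2"
    for c :: "nat \<Rightarrow> real"
    unfolding sq[symmetric] by (intro sum.cong refl) (simp add: point_moments_def)
  moreover have "(\<Sum>i<d. \<Sum>j<d. c i * c j * (point_moments d x $ (i + j) - point_moments d x $ (i + j + 2)))
      = (1 - x\<^sup>2) * (\<Sum>i<d. c i * x ^ i)\<^sup>2"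
    for c :: "nat \<Rightarrow> real"
    unfolding sq[symmetric] sum_distrib_left
    by (intro sum.cong refl) (simp add: point_moments_def algebra_simps power_add power2_eq_square)
  moreover have "0 \<le> 1 - x\<^sup>2" using assms by (simp add: abs_square_le_1 abs_le_iff)
  ultimately show ?thesis
    unfolding pseudo_moments_def moment_mat_psd_iff localizing_mat_psd_iff
    by (simp add: point_moments_def)
qed

lemma pseudo_moments_zero: "pseudo_moments d (0\<^sub>v (2 * d + 1))"
  unfolding pseudo_moments_def moment_mat_psd_iff localizing_mat_psd_iff by (auto intro!: sum_nonneg)

section \<open>Integrating out one variable at a time\<close>

text \<open>
  A polynomial given by coefficients \<open>c\<close> and exponents \<open>e\<close> that is nonnegative on the cube stays
  nonnegative when powers of the variables are replaced by entries of pseudo-moment vectors. In the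
  induction on the set of variables, the powers of the variable \<open>j\<close> are replaced first: for fixed
  values \<open>x\<close> of the others, the polynomial in \<open>j\<close> alone is nonnegative on the interval. The new
  factors \<open>\<nu> j $ e n j\<close> are then absorbed into the coefficients, which is why \<open>c\<close> is
  arbitrary.
\<close>

lemma product_moments_nonneg:
  fixes c :: "'a \<Rightarrow> real" and e :: "'a \<Rightarrow> 'b \<Rightarrow> nat"
  assumes "finite I" and N: "finite N"
    and \<nu>: "\<And>i. i \<in> I \<Longrightarrow> pseudo_moments d (\<nu> i)"
    and e: "\<And>n i. n \<in> N \<Longrightarrow> i \<in> I \<Longrightarrow> e n i \<le> d"
    and nonneg: "\<And>x. x \<in> I \<rightarrow> {-1..1} \<Longrightarrow> 0 \<le> (\<Sum>n\<in>N. c n * (\<Prod>i\<in>I. x i ^ e n i))"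
  shows "0 \<le> (\<Sum>n\<in>N. c n * (\<Prod>i\<in>I. \<nu> i $ e n i))"
  using assms(1,3-)
proof (induction I arbitrary: c rule: finite_induct)
  case (insert j I)
  have "0 \<le> (\<Sum>n\<in>N. (c n * \<nu> j $ e n j) * (\<Prod>i\<in>I. \<nu> i $ e n i))"
  proof (rule insert.IH)
    fix x :: "'b \<Rightarrow> real" assume x: "x \<in> I \<rightarrow> {-1..1}"
    define a where "a n = c n * (\<Prod>i\<in>I. x i ^ e n i)" for n
    define f where "f = (\<Sum>n\<in>N. monom (a n) (e n j))"
    have "0 \<le> poly f t" if "t \<in> {-1..1}" for t
    proof -
      have "(\<Prod>i\<in>I. (x(j := t)) i ^ e n i) = (\<Prod>i\<in>I. x i ^ e n i)" for n
        using insert.hyps by (intro prod.cong) auto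
      moreover have "x(j := t) \<in> insert j I \<rightarrow> {-1..1}" using x that by auto
      moreover note insert.prems(3)[OF this]
      ultimately show ?thesis
        using insert.hyps by (simp add: f_def a_def poly_sum poly_monom ac_simps del: fun_upd_apply)
          (simp add: ac_simps)
    qed
    moreover have "degree f \<le> d"
      unfolding f_def
      by (intro degree_sum_le N order_trans[OF degree_monom_le] insert.prems(2)) simp_all
    ultimately have "0 \<le> riesz (\<nu> j) f"
      using riesz_nonneg[of d "\<nu> j" f] insert.prems(1) by simp
    also have "riesz (\<nu> j) f = (\<Sum>n\<in>N. a n * \<nu> j $ e n j)"
    proof -
      have "e n j < dim_vec (\<nu> j)" if "n \<in> N" for n
        using insert.prems(1)[of j] insert.prems(2)[OF that, of j] by (auto simp: pseudo_moments_def)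
      then show ?thesis by (simp add: f_def riesz_sum riesz_monom)
    qed
    finally show "0 \<le> (\<Sum>n\<in>N. (c n * \<nu> j $ e n j) * (\<Prod>i\<in>I. x i ^ e n i))"
      by (simp add: a_def ac_simps)
  qed (use insert.prems in auto)
  then show ?case using insert.hyps by (simp add: ac_simps)
qed simp

text \<open>
  Subtracting \<open>m\<close> from the constant coefficient of \<open>p\<close>. The index 0 is added to the range of
  summation because \<open>p\<close> may have no constant term.
\<close>

lemma sum_keys_minus_const:
  fixes p :: "'a::zero \<Rightarrow>\<^sub>0 real"
  shows "(\<Sum>n\<in>insert 0 (Poly_Mapping.keys p). (Poly_Mapping.lookup p n - (if n = 0 then m else 0)) * g n)
     = (\<Sum>n\<in>Poly_Mapping.keys p. Poly_Mapping.lookup p n * g n) - m * g 0"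
proof -
  have "(\<Sum>n\<in>insert 0 (Poly_Mapping.keys p). Poly_Mapping.lookup p n * g n)
      = (\<Sum>n\<in>Poly_Mapping.keys p. Poly_Mapping.lookup p n * g n)"
    by (rule sum.mono_neutral_right) (auto simp: in_keys_iff)
  moreover have "(\<Sum>n\<in>insert 0 (Poly_Mapping.keys p). (if n = 0 then m else 0) * g n) = m * g 0"
    by (subst sum.mono_neutral_right[of _ "{0}"]) auto
  ultimately show ?thesis by (simp only: left_diff_distrib sum_subtractf)
qed

lemma relax_feasible_iff:
  "\<mu> \<in> relax_feasible D d L \<longleftrightarrow>
     \<mu> \<in> {1..L} \<rightarrow>\<^sub>E ({1..D} \<rightarrow>\<^sub>E carrier_vec (2 * d + 1)) \<and>
     (\<forall>l\<in>{1..L}. \<forall>i\<in>{1..D}. pseudo_moments d (\<mu> l i)) \<and> phi D L 0 \<mu> = 1"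
proof -
  have "\<mu> l i \<in> carrier_vec (2 * d + 1)"
    if "\<mu> \<in> {1..L} \<rightarrow>\<^sub>E ({1..D} \<rightarrow>\<^sub>E carrier_vec (2 * d + 1))" "l \<in> {1..L}" "i \<in> {1..D}" for l i
    using PiE_mem[OF PiE_mem[OF that(1,2)] that(3)] .
  then show ?thesis unfolding relax_feasible_def pseudo_moments_def mem_Collect_eq by blast
qed

lemma relax_objective_eq_sum:
  "relax_objective D L p \<mu> =
     (\<Sum>l=1..L. \<Sum>n\<in>Poly_Mapping.keys p. Poly_Mapping.lookup p n * (\<Prod>i=1..D. \<mu> l i $ Poly_Mapping.lookup n i))"
  unfolding relax_objective_def phi_def sum_distrib_left by (rule sum.swap)

lemma lookup_le_mi_size: "i \<in> {1..D} \<Longrightarrow> Poly_Mapping.lookup n i \<le> mi_size D n"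
  unfolding mi_size_def by (rule member_le_sum) auto

lemma mpoly_val_restrict: "mpoly_val D p (restrict x {1..D}) = mpoly_val D p x"
  by (simp add: mpoly_val_def monomial_val_def)

text \<open>
  The product functional of each summand \<open>l\<close> is applied to \<open>p - m\<close>. The constant \<open>m\<close> gets
  multiplied by the total mass of that summand, and the normalization makes the masses add up to 1.
\<close>

lemma relax_objective_lower_bound:
  assumes \<mu>: "\<mu> \<in> relax_feasible D d L" and p: "p \<in> mpolys_upto D d"
    and m: "\<And>x. x \<in> sym_cube D \<Longrightarrow> m \<le> mpoly_val D p x"
  shows "m \<le> relax_objective D L p \<mu>"
proof -
  let ?N = "insert 0 (Poly_Mapping.keys p)"
  define c where "c n = Poly_Mapping.lookup p n - (if n = 0 then m else 0)" for n
  have "0 \<le> (\<Sum>n\<in>Poly_Mapping.keys p. Poly_Mapping.lookup p n * (\<Prod>i=1..D. \<mu> l i $ Poly_Mapping.lookup n i))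
      - m * (\<Prod>i=1..D. \<mu> l i $ 0)" if l: "l \<in> {1..L}" for l
  proof -
    have "0 \<le> (\<Sum>n\<in>?N. c n * (\<Prod>i=1..D. \<mu> l i $ Poly_Mapping.lookup n i))"
    proof (rule product_moments_nonneg)
      show "pseudo_moments d (\<mu> l i)" if "i \<in> {1..D}" for i
        using \<mu> l that by (simp add: relax_feasible_iff)
      show "Poly_Mapping.lookup n i \<le> d" if n: "n \<in> ?N" and i: "i \<in> {1..D}" for n i
      proof (cases "n = 0")
        case False
        with n p have "mi_size D n \<le> d" by (auto simp: mpolys_upto_def)
        with lookup_le_mi_size[OF i, of n] show ?thesis by simp
      qed simp
      fix x :: "nat \<Rightarrow> real" assume "x \<in> {1..D} \<rightarrow> {-1..1}"
      then have "restrict x {1..D} \<in> sym_cube D" by (auto simp: sym_cube_def)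
      from m[OF this] show "0 \<le> (\<Sum>n\<in>?N. c n * (\<Prod>i=1..D. x i ^ Poly_Mapping.lookup n i))"
        unfolding c_def sum_keys_minus_const mpoly_val_restrict
        by (simp add: mpoly_val_def monomial_val_def)
    qed simp_all
    then show ?thesis unfolding c_def sum_keys_minus_const by simp
  qed
  then have "0 \<le> (\<Sum>l=1..L. (\<Sum>n\<in>Poly_Mapping.keys p. Poly_Mapping.lookup p n * (\<Prod>i=1..D. \<mu> l i $ Poly_Mapping.lookup n i))
      - m * (\<Prod>i=1..D. \<mu> l i $ 0))"
    by (rule sum_nonneg)
  also have "\<dots> = relax_objective D L p \<mu> - m * phi D L 0 \<mu>"
    unfolding sum_subtractf relax_objective_eq_sum phi_def sum_distrib_left by simp
  finally show ?thesis using \<mu> by (simp add: relax_feasible_iff)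
qed

section \<open>Attainment\<close>

text \<open>
  The cube consists of extensional functions, so it is compact in the product of the real lines
  over \<open>{1..D}\<close> by Tychonoff's theorem.
\<close>

lemma mpoly_val_attains_min_on_cube:
  "\<exists>x\<in>sym_cube D. \<forall>y\<in>sym_cube D. mpoly_val D p x \<le> mpoly_val D p y"
proof -
  let ?T = "product_topology (\<lambda>_. euclideanreal) {1..D}"
  have "compactin ?T (sym_cube D)"
    unfolding sym_cube_def by (subst compactin_PiE) auto
  moreover have "continuous_map ?T euclideanreal (mpoly_val D p)"
    unfolding mpoly_val_def monomial_val_def
    by (intro continuous_map_sum continuous_map_real_mult continuous_map_prod
        continuous_map_real_pow continuous_map_product_projection) auto
  ultimately have "compact (mpoly_val D p ` sym_cube D)"
    using image_compactin by fastforce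
  moreover have "sym_cube D \<noteq> {}"
    by (auto simp: sym_cube_def PiE_eq_empty_iff)
  ultimately show ?thesis
    using compact_attains_inf[of "mpoly_val D p ` sym_cube D"] by auto
qed

text \<open>
  The Dirac measure at \<open>x\<close> in the first summand and the zero measure in the others. The masses are
  not spread evenly over the summands, which would require taking roots.
\<close>

definition point_family :: "nat \<Rightarrow> nat \<Rightarrow> nat \<Rightarrow> (nat \<Rightarrow> real) \<Rightarrow> moment_family" where
  "point_family D d L x = (\<lambda>l\<in>{1..L}. \<lambda>i\<in>{1..D}.
     if l = 1 then point_moments d (x i) else 0\<^sub>v (2 * d + 1))"

text \<open>
  The condition \<open>1 \<le> D\<close> makes the summands with \<open>l \<noteq> 1\<close> vanish: an empty product of zero
  masses would be 1.
\<close>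

lemma phi_point_family:
  assumes "1 \<le> D" "1 \<le> L" and n: "\<And>i. i \<in> {1..D} \<Longrightarrow> Poly_Mapping.lookup n i \<le> d"
  shows "phi D L n (point_family D d L x) = monomial_val D n x"
proof -
  have "(\<Prod>i=1..D. point_family D d L x l i $ Poly_Mapping.lookup n i)
      = (if l = 1 then monomial_val D n x else 0)" if "l \<in> {1..L}" for l
  proof (cases "l = 1")
    case True
    have "Poly_Mapping.lookup n i < 2 * d + 1" if "i \<in> {1..D}" for i
      using n[OF that] by simp
    then have "(\<Prod>i=1..D. point_family D d L x l i $ Poly_Mapping.lookup n i) = monomial_val D n x"
      unfolding monomial_val_def using True that
      by (intro prod.cong refl) (simp add: point_family_def point_moments_def)
    then show ?thesis using True by simp
  next
    case False
    have "point_family D d L x l 1 $ Poly_Mapping.lookup n 1 = 0"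
      using False that assms(1) n[of 1] by (simp add: point_family_def)
    then have "(\<Prod>i=1..D. point_family D d L x l i $ Poly_Mapping.lookup n i) = 0"
      using assms(1) by (intro prod_zero) auto
    then show ?thesis using False by simp
  qed
  then have "phi D L n (point_family D d L x) = (\<Sum>l=1..L. if l = 1 then monomial_val D n x else 0)"
    unfolding phi_def by (intro sum.cong refl)
  then show ?thesis using assms(2) by simp
qed

lemma point_family_feasible:
  assumes "1 \<le> D" "1 \<le> L" "x \<in> sym_cube D"
  shows "point_family D d L x \<in> relax_feasible D d L"
proof -
  have "pseudo_moments d (point_family D d L x l i)" if "l \<in> {1..L}" "i \<in> {1..D}" for l i
  proof -
    have "x i \<in> {-1..1}" using assms(3) that by (auto simp: sym_cube_def)
    then show ?thesis
      using that pseudo_moments_point[of "x i" d] pseudo_moments_zero[of d]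
      by (simp add: point_family_def del: atLeastAtMost_iff)
  qed
  moreover have "phi D L 0 (point_family D d L x) = 1"
    using phi_point_family[of D L 0 d x] assms by (simp add: monomial_val_def)
  moreover have "point_family D d L x \<in> {1..L} \<rightarrow>\<^sub>E ({1..D} \<rightarrow>\<^sub>E carrier_vec (2 * d + 1))"
    by (auto simp: point_family_def point_moments_def)
  ultimately show ?thesis by (simp add: relax_feasible_iff)
qed

lemma relax_objective_point_family:
  assumes "1 \<le> D" "1 \<le> L" "p \<in> mpolys_upto D d"
  shows "relax_objective D L p (point_family D d L x) = mpoly_val D p x"
proof -
  have "phi D L n (point_family D d L x) = monomial_val D n x" if "n \<in> Poly_Mapping.keys p" for n
  proof (rule phi_point_family[OF assms(1,2)])
    have "mi_size D n \<le> d" using that assms(3) by (auto simp: mpolys_upto_def)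
    then show "Poly_Mapping.lookup n i \<le> d" if "i \<in> {1..D}" for i
      using lookup_le_mi_size[OF that, of n] by simp
  qed
  then show ?thesis by (simp add: relax_objective_def mpoly_val_def)
qed

theorem theorem2p2:
  fixes D d L :: nat and p :: real_mpoly
  assumes "D \<ge> 1" and "d \<ge> 1" and "L \<ge> 1"
    and "p \<in> mpolys_upto D d"
  shows "\<exists>x \<mu>. is_arg_min (mpoly_val D p) (\<lambda>y. y \<in> sym_cube D) x
           \<and> is_arg_min (relax_objective D L p) (\<lambda>\<eta>. \<eta> \<in> relax_feasible D d L) \<mu>
           \<and> mpoly_val D p x = relax_objective D L p \<mu>"
proof -
  obtain x where x: "x \<in> sym_cube D" "\<And>y. y \<in> sym_cube D \<Longrightarrow> mpoly_val D p x \<le> mpoly_val D p y"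
    using mpoly_val_attains_min_on_cube by blast
  let ?\<mu> = "point_family D d L x"
  have val: "relax_objective D L p ?\<mu> = mpoly_val D p x"
    by (rule relax_objective_point_family[OF assms(1,3,4)])
  have "mpoly_val D p x \<le> relax_objective D L p \<eta>" if "\<eta> \<in> relax_feasible D d L" for \<eta>
    using that assms(4) x(2) by (rule relax_objective_lower_bound)
  then have "is_arg_min (relax_objective D L p) (\<lambda>\<eta>. \<eta> \<in> relax_feasible D d L) ?\<mu>"
    using point_family_feasible[OF assms(1,3) x(1)] val by (force simp: is_arg_min_def)
  moreover have "is_arg_min (mpoly_val D p) (\<lambda>y. y \<in> sym_cube D) x"
    using x by (force simp: is_arg_min_def)
  ultimately show ?thesis using val by metis
qed

end
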